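(* Let $m,p\in\mathbb{N}$ and $0<x<2\pi$. Define $Q(t)=\prod_{i=1}^{p}(2t+2m+2i-1)$, $a_k=-\frac{2m+2k-1}{2}$ and $C_k=\frac{1}{Q'(a_k)}$ for $k=1,\dots,p$. Then $$\sum_{n=1}^\infty\frac{(m+n)_p}{(2n)_{2p+2m}}\,\zeta(2n)\left(\frac{x}{2\pi}\right)^{2n}=\frac{1}{2^{p-1}}\sum_{k=1}^p C_k\sum_{j=0}^{2k-1}(-1)^j\left(\prod_{i=1}^j(2k-i)\right)\sum_{n=1}^\infty\frac{\zeta(2n)\left(\frac{x}{2\pi}\right)^{2n}}{(2n)_{2m+j+1}}.$$
   Context: $\mathbb{N}=\{1,2,3,\dots\}$. $\zeta$ is the Riemann zeta function. $(z)_r=z(z+1)\cdots(z+r-1)$ is the Pochhammer symbol (rising factorial). $Q'$ denotes the derivative of the polynomial $Q$; the $C_k$ are the coefficients of the partial fraction decomposition $\frac{1}{Q(t)}=\sum_{k=1}^p\frac{C_k}{t-a_k}$. An empty product equals $1$. *)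

theory Defs
  imports Complex_Main "HOL-Computational_Algebra.Polynomial"
begin

text \<open>
  The Riemann zeta function on its half-line of absolute convergence \<open>s > 1\<close>, given by its
  Dirichlet series. Outside that range the value of this constant is meaningless: no analytic
  continuation is attempted, since only the arguments \<open>2 * n\<close> with \<open>n \<ge> 1\<close> are used.
\<close>

definition riemann_zeta :: "real \<Rightarrow> real" where
  "riemann_zeta s = (\<Sum>n. 1 / real (Suc n) powr s)"

end

theory Submission
  imports Defs "HOL-Analysis.Summation_Tests"
begin

text \<open>
  The identity holds term by term in \<open>n\<close>: every series contains the factor
  \<open>\<zeta>(2n) (x / 2\<pi>)\<^sup>2\<^sup>n\<close>, and what remains is an identity between rational functions of \<open>n\<close>.

  By the duplication formula for the rising factorial, the even factors of \<open>(2n + 2m)\<^sub>2\<^sub>p\<close> cancel \<open>(m + n)\<^sub>p\<close> up to a power of two and the odd ones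
  form \<open>Q(n)\<close>, so that
  \<open>(m + n)\<^sub>p / (2n)\<^sub>2\<^sub>m\<^sub>+\<^sub>2\<^sub>p = 1 / (2\<^sup>p (2n)\<^sub>2\<^sub>m Q(n))\<close>. The partial fraction decomposition of \<open>1 / Q\<close>
  (\<open>partial_fractions_simple_roots\<close>) turns this into a combination of the terms
  \<open>1 / ((2n)\<^sub>2\<^sub>m (2n + 2m + 2k - 1))\<close>. Finally each shifted reciprocal \<open>1 / (w + L)\<close>, here with
  \<open>w = 2n + 2m\<close> and \<open>L = 2k - 1\<close>, is a finite inverse factorial series in \<open>w\<close>
  (\<open>inverse_factorial_expansion\<close>), and \<open>(2n)\<^sub>2\<^sub>m\<close> merges with \<open>(w)\<^sub>j\<^sub>+\<^sub>1\<close> into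
  \<open>(2n)\<^sub>2\<^sub>m\<^sub>+\<^sub>j\<^sub>+\<^sub>1\<close>. Since \<open>\<zeta>\<close> is bounded on \<open>[2, \<infinity>)\<close>, all the series on the right are dominated
  by a geometric series, and the finite combination may be summed termwise, which also
  shows that the series on the left converges.
\<close>

text \<open>
  Adjoining one more root \<open>b\<close> splits \<open>1 / ((t - a\<^sub>k)(t - b))\<close> into a term at \<open>a\<^sub>k\<close> and a term at \<open>b\<close>;
  the coefficients at \<open>b\<close> add up to the negative of the induction hypothesis evaluated at \<open>t = b\<close>.
\<close>

lemma partial_fractions_monic:
  fixes a :: "'i \<Rightarrow> 'a :: field"
  assumes "finite I" "I \<noteq> {}" "inj_on a I" "t \<notin> a ` I"
  shows "1 / (\<Prod>i\<in>I. t - a i) = (\<Sum>k\<in>I. 1 / ((\<Prod>i\<in>I - {k}. a k - a i) * (t - a k)))"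
  using assms
proof (induction I arbitrary: t rule: finite_ne_induct)
  case (singleton b)
  then show ?case by simp
next
  case (insert b I)
  let ?c = "\<lambda>k. 1 / (\<Prod>i\<in>I - {k}. a k - a i)"
  have inj: "inj_on a I" and b: "b \<notin> I" and bI: "b \<notin> I" "a b \<notin> a ` I" and tI: "t \<notin> a ` I" and tb: "t \<noteq> a b"
    using insert.prems insert.hyps by auto
  have *: "1 / ((\<Prod>i\<in>insert b I - {k}. a k - a i) * (t - a k))
        = ?c k / (t - a k) * (1 / (t - a b)) + ?c k / (a b - a k) * (- 1 / (t - a b))"
    if k: "k \<in> I" for k
  proof -
    have ne: "a k \<noteq> a b" "t \<noteq> a k" using k bI tI by (metis imageI)+
    have "insert b I - {k} = insert b (I - {k})" using k b by auto
    then have "1 / ((\<Prod>i\<in>insert b I - {k}. a k - a i) * (t - a k)) = ?c k * (1 / ((a k - a b) * (t - a k)))"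
      using insert.hyps b by simp
    also have "1 / ((a k - a b) * (t - a k))
        = 1 / (t - a k) * (1 / (t - a b)) + 1 / (a b - a k) * (- 1 / (t - a b))"
      using ne tb by (simp add: divide_simps) (simp add: algebra_simps)
    finally show ?thesis
      by (simp add: diff_divide_distrib mult_ac)
  qed
  have "(\<Sum>k\<in>I. 1 / ((\<Prod>i\<in>insert b I - {k}. a k - a i) * (t - a k)))
      = (\<Sum>k\<in>I. ?c k / (t - a k)) * (1 / (t - a b)) + (\<Sum>k\<in>I. ?c k / (a b - a k)) * (- 1 / (t - a b))"
    by (simp only: * sum.distrib sum_distrib_right cong: sum.cong)
  also have "\<dots> = 1 / (\<Prod>i\<in>I. t - a i) * (1 / (t - a b)) + 1 / (\<Prod>i\<in>I. a b - a i) * (- 1 / (t - a b))"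
    using insert.IH[OF inj tI] insert.IH[OF inj bI(2)] by simp
  finally show ?case
    using insert.hyps b by (simp add: field_simps)
qed

text \<open>
  Only the summand of the product rule that differentiates the factor vanishing at \<open>a\<^sub>k\<close> survives
  there. This identifies the coefficients above, up to the
  leading coefficient of \<open>Q\<close>, with \<open>1 / Q'(a\<^sub>k)\<close>.
\<close>

lemma poly_pderiv_prod_at_root:
  fixes a :: "'i \<Rightarrow> 'a :: field"
  assumes "finite I" "k \<in> I"
  shows "poly (pderiv (\<Prod>i\<in>I. [: - (c * a i), c :])) (a k) = c ^ card I * (\<Prod>i\<in>I - {k}. a k - a i)"
proof -
  have lin: "poly [: - (c * a i), c :] t = c * (t - a i)" for i t
    by (simp add: algebra_simps)
  have split: "(\<Prod>i\<in>I. [: - (c * a i), c :]) = [: - (c * a k), c :] * (\<Prod>i\<in>I - {k}. [: - (c * a i), c :])"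
    using assms by (rule prod.remove)
  have "poly (pderiv (\<Prod>i\<in>I. [: - (c * a i), c :])) (a k) = c * (\<Prod>i\<in>I - {k}. c * (a k - a i))"
    unfolding split by (simp add: pderiv_mult pderiv_pCons poly_prod lin algebra_simps del: mult_pCons_left)
  also have "\<dots> = c * c ^ card (I - {k}) * (\<Prod>i\<in>I - {k}. a k - a i)"
    by (simp add: prod.distrib)
  also have "c * c ^ card (I - {k}) = c ^ card I"
    using card.remove[OF assms] by simp
  finally show ?thesis .
qed

lemma partial_fractions_simple_roots:
  fixes a :: "'i \<Rightarrow> 'a :: field"
  assumes "finite I" "I \<noteq> {}" "inj_on a I" "t \<notin> a ` I"
    and Q: "Q = (\<Prod>i\<in>I. [: - (c * a i), c :])"
  shows "1 / poly Q t = (\<Sum>k\<in>I. 1 / poly (pderiv Q) (a k) / (t - a k))"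
proof -
  have "poly Q t = c ^ card I * (\<Prod>i\<in>I. t - a i)"
  proof -
    have "poly Q t = (\<Prod>i\<in>I. c * (t - a i))"
      unfolding Q poly_prod by (intro prod.cong) (simp_all add: algebra_simps)
    then show ?thesis by (simp add: prod.distrib)
  qed
  then have "1 / poly Q t = 1 / c ^ card I * (1 / (\<Prod>i\<in>I. t - a i))"
    by simp
  also have "\<dots> = (\<Sum>k\<in>I. 1 / poly (pderiv Q) (a k) / (t - a k))"
    unfolding partial_fractions_monic[OF assms(1-4)] Q sum_distrib_left
    by (intro sum.cong) (simp_all add: poly_pderiv_prod_at_root[OF assms(1)] mult.assoc)
  finally show ?thesis .
qed

text \<open>
  Iterating \<open>1 / (w + L) = 1 / (w + r) - (L - r) / ((w + r)(w + L))\<close> for \<open>r = 0, 1, \<dots>\<close> produces an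
  inverse factorial series whose remainder is explicit.
\<close>

lemma inverse_factorial_expansion_remainder:
  fixes w L :: "'a :: field"
  assumes "w + L \<noteq> 0" and "\<And>i. i < r \<Longrightarrow> w + of_nat i \<noteq> 0"
  shows "1 / (w + L)
    = (\<Sum>j<r. (- 1) ^ j * (\<Prod>i<j. L - of_nat i) / pochhammer w (Suc j))
      + (- 1) ^ r * (\<Prod>i<r. L - of_nat i) / (pochhammer w r * (w + L))"
  using assms(2)
proof (induction r)
  case 0
  then show ?case by simp
next
  case (Suc r)
  have r: "w + of_nat r \<noteq> 0" using Suc.prems by simp
  have step: "1 / (w + L) = 1 / (w + of_nat r) - (L - of_nat r) / ((w + of_nat r) * (w + L))"
    using r assms(1) by (simp add: divide_simps)
  let ?A = "(- 1) ^ r * (\<Prod>i<r. L - of_nat i) / pochhammer w r"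
  have "(- 1) ^ r * (\<Prod>i<r. L - of_nat i) / (pochhammer w r * (w + L)) = ?A * (1 / (w + L))"
    by simp
  also have "\<dots> = ?A / (w + of_nat r) - ?A * ((L - of_nat r) / ((w + of_nat r) * (w + L)))"
    by (subst step) (simp add: right_diff_distrib)
  also have "?A / (w + of_nat r) = (- 1) ^ r * (\<Prod>i<r. L - of_nat i) / pochhammer w (Suc r)"
    by (simp add: pochhammer_Suc)
  also have "?A * ((L - of_nat r) / ((w + of_nat r) * (w + L)))
      = - ((- 1) ^ Suc r * (\<Prod>i<Suc r. L - of_nat i) / (pochhammer w (Suc r) * (w + L)))"
    by (simp add: pochhammer_Suc mult.assoc)
  finally show ?case
    using Suc by simp
qed

text \<open>For a natural number \<open>L\<close> the remainder after \<open>L + 1\<close> terms contains the factor \<open>L - L = 0\<close>.\<close>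

lemma inverse_factorial_expansion:
  fixes w :: real
  assumes "w > 0"
  shows "1 / (w + real l) = (\<Sum>j\<le>l. (- 1) ^ j * (\<Prod>i<j. real l - real i) / pochhammer w (Suc j))"
proof -
  have "(\<Prod>i<Suc l. real l - real i) = 0" by simp
  moreover have "w + real l \<noteq> 0" "\<And>i. w + real i \<noteq> 0"
    using assms by (simp_all add: add_pos_nonneg less_imp_neq[symmetric])
  ultimately show ?thesis
    using inverse_factorial_expansion_remainder[of w "real l" "Suc l"]
    by (simp add: lessThan_Suc_atMost)
qed

text \<open>
  The duplication formula \<open>(2y)\<^sub>2\<^sub>p = 4\<^sup>p (y)\<^sub>p (y + 1/2)\<^sub>p\<close> at \<open>y = m + z\<close>: the factor \<open>(y)\<^sub>p\<close> cancels,
  and half of the power of two turns \<open>(y + 1/2)\<^sub>p\<close> into the product of the odd shifts.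
\<close>

lemma pochhammer_over_double:
  fixes z :: real
  assumes "z > 0"
  shows "pochhammer (real m + z) p / pochhammer (2 * z) (2 * p + 2 * m)
    = 1 / (2 ^ p * pochhammer (2 * z) (2 * m) * (\<Prod>i=1..p. 2 * z + 2 * real m + 2 * real i - 1))"
proof -
  let ?y = "real m + z"
  have "pochhammer (2 * z) (2 * p + 2 * m) = pochhammer (2 * z) (2 * m) * pochhammer (2 * ?y) (2 * p)"
    by (subst add.commute, subst pochhammer_product') (simp add: algebra_simps)
  also have "pochhammer (2 * ?y) (2 * p) = 4 ^ p * pochhammer ?y p * pochhammer (?y + 1 / 2) p"
    by (simp only: pochhammer_double power_mult) simp
  also have "4 ^ p * pochhammer ?y p * pochhammer (?y + 1 / 2) p
      = 2 ^ p * pochhammer ?y p * (2 ^ p * pochhammer (?y + 1 / 2) p)"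
    by (simp add: power_mult_distrib[symmetric])
  also have "2 ^ p * pochhammer (?y + 1 / 2) p = (\<Prod>i=0..<p. 2 * (?y + 1 / 2 + real i))"
    by (simp only: pochhammer_prod prod.distrib prod_constant card_atLeastLessThan diff_zero)
  also have "\<dots> = (\<Prod>i=1..p. 2 * z + 2 * real m + 2 * real i - 1)"
    by (intro prod.reindex_bij_witness[of _ "\<lambda>i. i - 1" Suc]) (auto simp: algebra_simps of_nat_diff)
  finally show ?thesis
    using pochhammer_pos[of ?y p] assms by simp
qed

text \<open>
  With \<open>z = n\<close> this is the identity between the factors of \<open>\<zeta>(2n) (x / 2\<pi>)\<^sup>2\<^sup>n\<close>. One of the
  \<open>p\<close> factors \<open>1 / 2\<close> from the duplication formula is used up by
  \<open>1 / (z - a\<^sub>k) = 2 / (2z + 2m + 2k - 1)\<close>, which leaves \<open>1 / 2\<^sup>p\<^sup>-\<^sup>1\<close>.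
\<close>

lemma coefficient_identity:
  fixes z :: real and a C :: "nat \<Rightarrow> real"
  assumes "p \<ge> 1" "z > 0"
    and Q: "Q = (\<Prod>i=1..p. [: 2 * real m + 2 * real i - 1, 2 :])"
    and a: "\<And>k. k \<in> {1..p} \<Longrightarrow> a k = - (2 * real m + 2 * real k - 1) / 2"
    and C: "\<And>k. k \<in> {1..p} \<Longrightarrow> C k = 1 / poly (pderiv Q) (a k)"
  shows "pochhammer (real m + z) p / pochhammer (2 * z) (2 * p + 2 * m)
    = 1 / 2 ^ (p - 1) * (\<Sum>k=1..p. C k *
        (\<Sum>j=0..2 * k - 1. (- 1) ^ j * (\<Prod>i=1..j. 2 * real k - real i) / pochhammer (2 * z) (2 * m + j + 1)))"
proof -
  let ?w = "2 * z + 2 * real m" and ?P = "pochhammer (2 * z) (2 * m)"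
  have inj: "inj_on a {1..p}"
    by (rule inj_onI) (simp add: a)
  have za: "z - a k = (?w + 2 * real k - 1) / 2" if "k \<in> {1..p}" for k
    using that by (simp add: a field_simps)
  have "a k < z" if "k \<in> {1..p}" for k
    using that assms(2) by (simp add: a field_simps)
  then have notin: "z \<notin> a ` {1..p}" by force
  have Q': "Q = (\<Prod>i=1..p. [: - (2 * a i), 2 :])"
    unfolding Q by (intro prod.cong) (simp_all add: a field_simps)
  have "poly Q z = (\<Prod>i=1..p. ?w + 2 * real i - 1)"
    unfolding Q poly_prod by (intro prod.cong) (simp_all add: algebra_simps)
  then have "pochhammer (real m + z) p / pochhammer (2 * z) (2 * p + 2 * m)
      = 1 / (2 ^ p * ?P) * (1 / poly Q z)"
    by (simp add: pochhammer_over_double[OF assms(2)])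
  also have "1 / poly Q z = (\<Sum>k=1..p. C k / (z - a k))"
    using partial_fractions_simple_roots[OF _ _ inj notin Q'] \<open>p \<ge> 1\<close> by (simp add: C)
  also have "\<dots> = (\<Sum>k=1..p. 2 * (C k * (1 / (?w + 2 * real k - 1))))"
    by (intro sum.cong) (simp_all add: za)
  also have "1 / (2 ^ p * ?P) * \<dots> = 1 / 2 ^ (p - 1) * (\<Sum>k=1..p. C k * (1 / ?P * (1 / (?w + 2 * real k - 1))))"
    using \<open>p \<ge> 1\<close> by (cases p) (simp_all del: sum.cl_ivl_Suc add: sum_distrib_left mult_ac)
  also have "(\<Sum>k=1..p. C k * (1 / ?P * (1 / (?w + 2 * real k - 1))))
      = (\<Sum>k=1..p. C k * (\<Sum>j=0..2 * k - 1. (- 1) ^ j * (\<Prod>i=1..j. 2 * real k - real i)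
            / pochhammer (2 * z) (2 * m + j + 1)))"
  proof (intro sum.cong refl arg_cong[where f = "(*) (C _)"])
    fix k assume "k \<in> {1..p}"
    then have L: "real (2 * k - 1) = 2 * real k - 1" by (simp add: of_nat_diff)
    have falling: "(\<Prod>i<j. real (2 * k - 1) - real i) = (\<Prod>i=1..j. 2 * real k - real i)" for j
      unfolding L by (intro prod.reindex_bij_witness[of _ "\<lambda>i. i - 1" Suc]) (auto simp: of_nat_diff)
    have merge: "pochhammer (2 * z) (2 * m + j + 1) = ?P * pochhammer ?w (Suc j)" for j
      using pochhammer_product'[of "2 * z" "2 * m" "Suc j"] by (simp add: add.assoc)
    have "1 / (?w + 2 * real k - 1) = 1 / (?w + real (2 * k - 1))"
      by (simp only: L add_diff_eq)
    also have "\<dots> = (\<Sum>j=0..2 * k - 1. (- 1) ^ j * (\<Prod>i=1..j. 2 * real k - real i) / pochhammer ?w (Suc j))"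
      using assms(2) by (subst inverse_factorial_expansion) (simp, simp only: falling atLeast0AtMost)
    finally show "1 / ?P * (1 / (?w + 2 * real k - 1))
        = (\<Sum>j=0..2 * k - 1. (- 1) ^ j * (\<Prod>i=1..j. 2 * real k - real i)
            / pochhammer (2 * z) (2 * m + j + 1))"
      unfolding merge by (simp add: sum_distrib_left)
  qed
  finally show ?thesis .
qed

lemma riemann_zeta_bounds:
  assumes "s \<ge> 2"
  shows "0 \<le> riemann_zeta s" "riemann_zeta s \<le> riemann_zeta 2"
proof -
  have "summable (\<lambda>n. real n powr - 2)"
    by (subst summable_real_powr_iff) simp
  then have sum2: "summable (\<lambda>n. 1 / real (Suc n) powr 2)"
    by (subst (asm) summable_Suc_iff[symmetric]) (simp add: powr_minus_divide)
  have le: "1 / real (Suc n) powr s \<le> 1 / real (Suc n) powr 2" for n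
    using assms by (intro divide_left_mono powr_mono) auto
  have sums: "summable (\<lambda>n. 1 / real (Suc n) powr s)"
    by (rule summable_comparison_test'[OF sum2, of 0]) (use le in simp)
  show "0 \<le> riemann_zeta s"
    unfolding riemann_zeta_def by (intro suminf_nonneg sums) simp
  show "riemann_zeta s \<le> riemann_zeta 2"
    unfolding riemann_zeta_def by (intro suminf_le sums sum2 le)
qed

lemma pochhammer_ge_1:
  fixes z :: real
  assumes "z \<ge> 1"
  shows "pochhammer z r \<ge> 1"
  unfolding pochhammer_prod using assms by (intro prod_ge_1) auto

text \<open>
  Boundedness of \<open>\<zeta>\<close> on \<open>[2, \<infinity>)\<close> gives a geometric majorant, the denominators being at least \<open>1\<close>.
\<close>

lemma summable_zeta_even_over_pochhammer:
  fixes y :: real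
  assumes "0 \<le> y" "y < 1"
  shows "summable (\<lambda>n. riemann_zeta (real (2 * Suc n)) * y ^ (2 * Suc n) / pochhammer (real (2 * Suc n)) r)"
proof (rule summable_comparison_test')
  have "summable (\<lambda>n. (y\<^sup>2) ^ n)"
    using assms by (intro summable_geometric) (simp add: power_less_one_iff)
  then show "summable (\<lambda>n. riemann_zeta 2 * (y\<^sup>2) ^ Suc n)"
    by (intro summable_mult) (simp add: summable_Suc_iff)
  fix n :: nat
  let ?t = "riemann_zeta (real (2 * Suc n)) * y ^ (2 * Suc n)"
  have z: "0 \<le> riemann_zeta (real (2 * Suc n))" "riemann_zeta (real (2 * Suc n)) \<le> riemann_zeta 2"
    by (rule riemann_zeta_bounds, simp)+
  have t0: "0 \<le> ?t" using z(1) assms(1) by simp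
  have P: "pochhammer (real (2 * Suc n)) r \<ge> 1" by (rule pochhammer_ge_1) simp
  have "norm (?t / pochhammer (real (2 * Suc n)) r) = ?t / pochhammer (real (2 * Suc n)) r"
    using t0 P by simp
  also have "\<dots> \<le> ?t / 1"
    using t0 P by (intro divide_left_mono) auto
  also have "\<dots> \<le> riemann_zeta 2 * y ^ (2 * Suc n)"
    using z(2) assms(1) by (simp del: mult_Suc_right power_Suc add: mult_right_mono)
  finally show "norm (?t / pochhammer (real (2 * Suc n)) r) \<le> riemann_zeta 2 * (y\<^sup>2) ^ Suc n"
    by (simp only: power_mult)
qed

theorem theorem1p3:
  fixes m p :: nat and x :: real
    and Q :: "real poly" and a C :: "nat \<Rightarrow> real"
  assumes "m \<ge> 1" and "p \<ge> 1" and "0 < x" and "x < 2 * pi"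
    and Q: "Q = (\<Prod>i=1..p. [: 2 * real m + 2 * real i - 1, 2 :])"
    and a: "\<And>k. k \<in> {1..p} \<Longrightarrow> a k = - (2 * real m + 2 * real k - 1) / 2"
    and C: "\<And>k. k \<in> {1..p} \<Longrightarrow> C k = 1 / poly (pderiv Q) (a k)"
  shows "summable (\<lambda>n. pochhammer (real (m + Suc n)) p
              / pochhammer (real (2 * Suc n)) (2 * p + 2 * m)
              * riemann_zeta (real (2 * Suc n)) * (x / (2 * pi)) ^ (2 * Suc n))
       \<and> (\<forall>k\<in>{1..p}. \<forall>j\<in>{0..2 * k - 1}.
            summable (\<lambda>n. riemann_zeta (real (2 * Suc n)) * (x / (2 * pi)) ^ (2 * Suc n)
              / pochhammer (real (2 * Suc n)) (2 * m + j + 1)))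
       \<and> (\<Sum>n. pochhammer (real (m + Suc n)) p
              / pochhammer (real (2 * Suc n)) (2 * p + 2 * m)
              * riemann_zeta (real (2 * Suc n)) * (x / (2 * pi)) ^ (2 * Suc n))
         = 1 / 2 ^ (p - 1) *
           (\<Sum>k=1..p. C k *
             (\<Sum>j=0..2 * k - 1. (- 1) ^ j * (\<Prod>i=1..j. 2 * real k - real i) *
               (\<Sum>n. riemann_zeta (real (2 * Suc n)) * (x / (2 * pi)) ^ (2 * Suc n)
                  / pochhammer (real (2 * Suc n)) (2 * m + j + 1))))"
proof -
  let ?y = "x / (2 * pi)"
  let ?g = "\<lambda>j n. riemann_zeta (real (2 * Suc n)) * ?y ^ (2 * Suc n)
              / pochhammer (real (2 * Suc n)) (2 * m + j + 1)"
  let ?c = "\<lambda>k j. (- 1) ^ j * (\<Prod>i=1..j. 2 * real k - real i)"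
  let ?f = "\<lambda>n. pochhammer (real (m + Suc n)) p / pochhammer (real (2 * Suc n)) (2 * p + 2 * m)
              * riemann_zeta (real (2 * Suc n)) * ?y ^ (2 * Suc n)"
  have y: "0 \<le> ?y" "?y < 1" using assms(3,4) by simp_all
  have g: "summable (?g j)" for j
    by (rule summable_zeta_even_over_pochhammer[OF y])
  have f: "?f n = 1 / 2 ^ (p - 1) * (\<Sum>k=1..p. C k * (\<Sum>j=0..2 * k - 1. ?c k j * ?g j n))" for n
  proof -
    have arg: "real (m + Suc n) = real m + real (Suc n)" "real (2 * Suc n) = 2 * real (Suc n)"
      by simp_all
    show ?thesis
      unfolding arg
      by (subst coefficient_identity[OF assms(2) _ Q a C])
        (simp_all add: sum_distrib_left sum_distrib_right mult_ac del: of_nat_Suc mult_Suc_right power_Suc)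
  qed
  have "?f sums (1 / 2 ^ (p - 1) * (\<Sum>k=1..p. C k * (\<Sum>j=0..2 * k - 1. ?c k j * (\<Sum>n. ?g j n))))"
    unfolding f by (intro sums_mult sums_sum summable_sums g)
  then show ?thesis
    using g by (auto simp only: sums_iff)
qed

end
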